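(* Let $X=Y\setminus Z\subset\mathbb P^n$ ($n\ge2$) be a (possibly singular) quasi-projective variety, $\mathcal S$ a Whitney stratification of $Y$ with $Z$ a union of strata, $\mathcal L$ a hyperplane transverse to $\mathcal S$, and $\mathcal P$ a pencil of hyperplanes having $\mathcal L$ as a member and whose axis $\mathcal M$ is transverse to $\mathcal S$. Assume $\mathcal M\cap X\ne\emptyset$ and let $*\in\mathcal M\cap X$. For every index $i$ of an exceptional hyperplane $\mathcal L_i$ and every integer $q\ge1$, the image of the generalized homotopical variation operator $\mathrm{VAR}_{i,q}\colon\pi_q(\mathcal L\cap X,\mathcal M\cap X,* )\to\pi_q(\mathcal L\cap X,* )$ is contained in the kernel of the natural map $\pi_q(\mathcal L\cap X,* )\to\pi_q(X,* )$ (induced by inclusion).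
   Context: $Y$ is a non-empty closed algebraic subset of $\mathbb P^n$ and $Z$ a proper closed algebraic subset of $Y$. All members of $\mathcal P$ are transverse to (all strata of) $\mathcal S$ except finitely many, called exceptional hyperplanes $(\mathcal L_i)_i$ (one may also count finitely many ordinary members different from $\mathcal L$ as exceptional). Parametrize $\mathcal P$ by $\mathbb P^1$ as usual: $\mathcal P(\mu)$ is the member with parameter $\mu$, $\mathcal L=\mathcal P(\lambda)$, $\mathcal L_i=\mathcal P(\lambda_i)$. For $G\subset\mathbb P^n$, $E\subset\mathbb P^1$, put $G_E=\bigcup_{\mu\in E}G\cap\mathcal P(\mu)$. Loops. For each $i$ let $D_i\subset\mathbb P^1$ be a small closed semi-analytic disk with centre $\lambda_i$, the $D_i$ mutually disjoint, $\gamma_i\in\partial D_i$, and $\Gamma_i$ the image of a simple real-analytic arc joining $\lambda$ to $\gamma_i$, with $\Gamma_i\cap D_i=\{\gamma_i\}$, and $\Gamma_i\cap\Gamma_{i'}=\{\lambda\}$, $\Gamma_i\cap D_{i'}=\emptyset$ for $i\neq i'$. Put $K_i=\Gamma_i\cup D_i$. Let $\omega_i$ be the loop in $\partial K_i$ starting at $\lambda$, running along $\Gamma_i$ to $\gamma_i$, once counter-clockwise around $\partial D_i$, and back along $\Gamma_i$ to $\lambda$. Monodromy. For each $i$ there is an isotopy $\Theta\colon(\mathcal L\cap X)\times[0,1]\to X_{\partial K_i}$ with $\Theta(x,0)=x$, $\Theta(x,t)\in X_{\omega_i(t)}$, $x\mapsto\Theta(x,t)$ a homeomorphism $\mathcal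 L\cap X\to X_{\omega_i(t)}$ for every $t$, and $\Theta(x,t)=x$ for $x\in\mathcal M\cap X$. The homeomorphism $h=\Theta(\cdot,1)$ of $\mathcal L\cap X$ is called a geometric monodromy of $\mathcal L\cap X$ relative to $\mathcal M\cap X$ above $\omega_i$; it fixes $\mathcal M\cap X$ pointwise. Generalized homotopical variation. Let $I=[0,1]$. For a pointed pair $(A,B,* )$, $*\in B$, $F^q(A,B,* )$ is the set of maps $I^q\to A$ sending the face $x_q=0$ into $B$ and all other faces to $*$, and $F^q(A,* )$ the set of maps $I^q\to A$ sending $\partial I^q$ to $*$; $\langle f\rangle$ denotes the homotopy class in $\pi_q(A,B,* )$, resp. $\pi_q(A,* )$. For $f\in F^q(\mathcal L\cap X,\mathcal M\cap X,* )$, let $f\bot(h\circ f)\in F^q(\mathcal L\cap X,* )$ be the map equal to $f(x_1,\dots,x_{q-1},1-2x_q)$ if $0\le x_q\le\frac12$ and to $h\circ f(x_1,\dots,x_{q-1},2x_q-1)$ if $\frac12\le x_q\le1$. Then $\mathrm{VAR}_{i,q}(\langle f\rangle)=\langle f\bot(h\circ f)\rangle$ is a well-defined map depending only on the homotopy class of $\omega_i$ in $\mathbb P^1\setminus\bigcup_j\{\lambda_j\}$. *)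

theory Defs
  imports "HOL-Complex_Analysis.Complex_Analysis" "HOL-Algebra.Coset"
begin

section \<open>Complex projective space\<close>

text \<open>
  The space of lines of \<open>complex ^ 'n\<close>, hence of dimension \<open>CARD('n) - 1\<close>. In particular
  \<open>2 proj\<close> is the projective line.
\<close>

typedef (overloaded) 'n proj = "{l :: (complex ^ 'n) set. vec.subspace l \<and> vec.dim l = 1}"
  morphisms line_of Abs_proj
proof -
  have "vec.dim (vec.span {axis undefined (1::complex) :: complex ^ 'n}) = 1"
    by (simp add: vec.dim_span vec.dim_singleton axis_eq_0_iff)
  then show ?thesis by blast
qed

definition hpt :: "complex ^ 'n \<Rightarrow> 'n proj"
  where "hpt v = Abs_proj (vec.span {v})"

text \<open>The topology is the quotient topology of the space of nonzero vectors.\<close>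

instantiation proj :: (finite) topological_space
begin

definition open_proj :: "'a proj set \<Rightarrow> bool"
  where "open_proj U \<longleftrightarrow> open {v. v \<noteq> 0 \<and> hpt v \<in> U}"

instance
proof
  show "open (UNIV :: 'a proj set)"
  proof -
    have "{v :: complex ^ 'a. v \<noteq> 0 \<and> hpt v \<in> UNIV} = - {0}" by auto
    then show ?thesis unfolding open_proj_def by (simp only: open_Compl closed_singleton)
  qed
next
  fix S T :: "'a proj set"
  assume "open S" "open T"
  moreover have "{v. v \<noteq> 0 \<and> hpt v \<in> S \<inter> T} = {v. v \<noteq> 0 \<and> hpt v \<in> S} \<inter> {v. v \<noteq> 0 \<and> hpt v \<in> T}"
    by auto
  ultimately show "open (S \<inter> T)" unfolding open_proj_def by (simp only: open_Int)
next
  fix K :: "'a proj set set"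
  assume "\<forall>S\<in>K. open S"
  moreover have "{v. v \<noteq> 0 \<and> hpt v \<in> \<Union>K} = (\<Union>S\<in>K. {v. v \<noteq> 0 \<and> hpt v \<in> S})"
    by auto
  ultimately show "open (\<Union>K)" unfolding open_proj_def by (simp only: open_UN)
qed

end

definition homogeneous_poly :: "(complex ^ 'n \<Rightarrow> complex) \<Rightarrow> bool"
  where "homogeneous_poly p \<longleftrightarrow>
    (\<exists>d E c. finite E \<and> (\<forall>e\<in>E. (\<Sum>i\<in>UNIV. e i) = (d::nat)) \<and>
      (\<forall>v. p v = (\<Sum>e\<in>E. c e * (\<Prod>i\<in>UNIV. v $ i ^ e i))))"

definition closed_algebraic :: "'n::finite proj set \<Rightarrow> bool"
  where "closed_algebraic A \<longleftrightarrow>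
    (\<exists>F. (\<forall>p\<in>F. homogeneous_poly p) \<and> A = {x. \<forall>p\<in>F. \<forall>v\<in>line_of x. p v = 0})"


section \<open>Complex submanifolds and transversality\<close>

definition holomorphic_vec_on :: "(complex ^ 'n \<Rightarrow> complex ^ 'n) \<Rightarrow> (complex ^ 'n) set \<Rightarrow> bool"
  where "holomorphic_vec_on f U \<longleftrightarrow>
    (\<forall>v\<in>U. \<exists>f'. (f has_derivative f') (at v) \<and> Vector_Spaces.linear (*s) (*s) f')"

definition submanifold :: "nat \<Rightarrow> (complex ^ 'n) set \<Rightarrow> bool"
  where "submanifold d M \<longleftrightarrow>
    (\<forall>w\<in>M. \<exists>U V \<phi> \<psi> E. open U \<and> open V \<and> w \<in> U \<and> homeomorphism U V \<phi> \<psi> \<and>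
      holomorphic_vec_on \<phi> U \<and> holomorphic_vec_on \<psi> V \<and>
      vec.subspace E \<and> vec.dim E = d \<and> \<phi> ` (M \<inter> U) = E \<inter> V)"

definition tangent_space :: "(complex ^ 'n) set \<Rightarrow> complex ^ 'n \<Rightarrow> (complex ^ 'n) set"
  where "tangent_space M w =
    {t. \<exists>c e. e > 0 \<and> c (0::real) = w \<and> (\<forall>s. \<bar>s\<bar> < e \<longrightarrow> c s \<in> M) \<and>
      (c has_vector_derivative t) (at 0)}"

text \<open>
  \<open>affine_part i A\<close> is \<open>A\<close> read in the chart \<open>[v] \<mapsto> v / v $ i\<close> of the open set \<open>v $ i \<noteq> 0\<close>. The
  chart takes its values in the affine hyperplane \<open>w $ i = 1\<close> of \<open>complex ^ 'n\<close>; a subset of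
  that hyperplane is a submanifold of it if and only if it is one of \<open>complex ^ 'n\<close>.
\<close>

definition affine_part :: "'n \<Rightarrow> 'n::finite proj set \<Rightarrow> (complex ^ 'n) set"
  where "affine_part i A = {w. w $ i = 1 \<and> hpt w \<in> A}"

definition proj_submanifold :: "nat \<Rightarrow> 'n::finite proj set \<Rightarrow> bool"
  where "proj_submanifold d S \<longleftrightarrow> (\<forall>i. submanifold d (affine_part i S))"

definition transverse :: "'n::finite proj set \<Rightarrow> 'n proj set \<Rightarrow> bool"
  where "transverse A B \<longleftrightarrow>
    (\<forall>i. \<forall>w \<in> affine_part i A \<inter> affine_part i B.
      {s + t | s t. s \<in> tangent_space (affine_part i A) w \<and> t \<in> tangent_space (affine_part i B) w}
        = tangent_space (affine_part i UNIV) w)"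


section \<open>Whitney stratifications\<close>

text \<open>
  Convergence in the Grassmannian, expressed by the operator norm of the difference of the
  orthogonal projections.
\<close>

definition grassmann_tendsto ::
    "(nat \<Rightarrow> (complex ^ 'n) set) \<Rightarrow> (complex ^ 'n) set \<Rightarrow> bool"
  where "grassmann_tendsto T \<tau> \<longleftrightarrow> vec.subspace \<tau> \<and>
    (\<lambda>k. onorm (\<lambda>v. closest_point (T k) v - closest_point \<tau> v)) \<longlonglongrightarrow> 0"

text \<open>Whitney's conditions for \<open>M\<close> along \<open>N\<close>.\<close>

definition whitney_a :: "(complex ^ 'n) set \<Rightarrow> (complex ^ 'n) set \<Rightarrow> bool"
  where "whitney_a M N \<longleftrightarrow>
    (\<forall>x\<in>N. \<forall>y \<tau>. (\<forall>k. y k \<in> M) \<and> y \<longlonglongrightarrow> x \<and>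
        grassmann_tendsto (\<lambda>k. tangent_space M (y k)) \<tau> \<longrightarrow>
      tangent_space N x \<subseteq> \<tau>)"

definition whitney_b :: "(complex ^ 'n) set \<Rightarrow> (complex ^ 'n) set \<Rightarrow> bool"
  where "whitney_b M N \<longleftrightarrow>
    (\<forall>x\<in>N. \<forall>y z l \<tau>. (\<forall>k. y k \<in> M \<and> z k \<in> N \<and> y k \<noteq> z k) \<and> y \<longlonglongrightarrow> x \<and> z \<longlonglongrightarrow> x \<and>
        grassmann_tendsto (\<lambda>k. vec.span {y k - z k}) l \<and>
        grassmann_tendsto (\<lambda>k. tangent_space M (y k)) \<tau> \<longrightarrow>
      l \<subseteq> \<tau>)"

text \<open>Strata have a fixed dimension, but are not required to be connected.\<close>

definition whitney_stratification :: "'n::finite proj set \<Rightarrow> 'n proj set set \<Rightarrow> bool"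
  where "whitney_stratification Y \<S> \<longleftrightarrow>
    finite \<S> \<and> {} \<notin> \<S> \<and> \<Union>\<S> = Y \<and> disjoint \<S> \<and>
    (\<forall>S\<in>\<S>. (\<exists>d. proj_submanifold d S) \<and>
      closed_algebraic (closure S) \<and> closed_algebraic (closure S - S)) \<and>
    (\<forall>S\<in>\<S>. \<forall>R\<in>\<S>. R \<inter> closure S \<noteq> {} \<longrightarrow> R \<subseteq> closure S) \<and>
    (\<forall>S\<in>\<S>. \<forall>R\<in>\<S>. S \<noteq> R \<longrightarrow>
      (\<forall>i. whitney_a (affine_part i S) (affine_part i R) \<and>
           whitney_b (affine_part i S) (affine_part i R)))"

definition transverse_to_strata :: "'n::finite proj set \<Rightarrow> 'n proj set set \<Rightarrow> bool"
  where "transverse_to_strata A \<S> \<longleftrightarrow> (\<forall>S\<in>\<S>. transverse A S)"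


section \<open>Pencils of hyperplanes\<close>

definition hyperplane :: "complex ^ 'n \<Rightarrow> 'n::finite proj set"
  where "hyperplane a = {x. \<forall>v\<in>line_of x. (\<Sum>i\<in>UNIV. a $ i * v $ i) = 0}"

definition is_pencil :: "(2 proj \<Rightarrow> 'n::finite proj set) \<Rightarrow> bool"
  where "is_pencil P \<longleftrightarrow>
    (\<exists>a b. a \<noteq> b \<and> vec.independent {a, b} \<and>
      (\<forall>m. m \<noteq> 0 \<longrightarrow> P (hpt m) = hyperplane (m $ 1 *s a + m $ 2 *s b)))"

definition pencil_axis :: "(2 proj \<Rightarrow> 'n::finite proj set) \<Rightarrow> 'n proj set"
  where "pencil_axis P = (\<Inter>\<mu>. P \<mu>)"

definition part_over :: "(2 proj \<Rightarrow> 'n::finite proj set) \<Rightarrow> 'n proj set \<Rightarrow> 2 proj set \<Rightarrow> 'n proj set"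
  where "part_over P G E = (\<Union>\<mu>\<in>E. G \<inter> P \<mu>)"


section \<open>Loops in the projective line\<close>

text \<open>
  The inverse of an affine coordinate: for independent \<open>u\<close> and \<open>w\<close> it is a biholomorphic
  map of the complex plane onto the complement of \<open>[u]\<close>. All notions on the projective line are
  read in such coordinates.
\<close>

definition aff_param :: "complex ^ 2 \<Rightarrow> complex ^ 2 \<Rightarrow> complex \<Rightarrow> 2 proj"
  where "aff_param u w z = hpt (z *s u + w)"

definition aff_frame :: "complex ^ 2 \<Rightarrow> complex ^ 2 \<Rightarrow> bool"
  where "aff_frame u w \<longleftrightarrow> u \<noteq> w \<and> vec.independent {u, w}"

definition real_analytic_fun_on :: "(complex \<Rightarrow> real) \<Rightarrow> complex set \<Rightarrow> bool"
  where "real_analytic_fun_on f V \<longleftrightarrow>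
    (\<forall>z0\<in>V. \<exists>a r. r > 0 \<and> (\<forall>z\<in>ball z0 r.
      ((\<lambda>(j, k). a j k * Re (z - z0) ^ j * Im (z - z0) ^ k) has_sum f z) (UNIV :: (nat \<times> nat) set)))"

definition semianalytic_plane :: "complex set \<Rightarrow> bool"
  where "semianalytic_plane A \<longleftrightarrow>
    (\<forall>z. \<exists>V \<B>. open V \<and> z \<in> V \<and> finite \<B> \<and> A \<inter> V = \<Union>\<B> \<and>
      (\<forall>B\<in>\<B>. \<exists>F G. finite F \<and> finite G \<and> (\<forall>f \<in> F \<union> G. real_analytic_fun_on f V) \<and>
        B = {y\<in>V. (\<forall>f\<in>F. f y = 0) \<and> (\<forall>g\<in>G. g y > 0)}))"

definition semianalytic :: "2 proj set \<Rightarrow> bool"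
  where "semianalytic D \<longleftrightarrow> (\<forall>u w. aff_frame u w \<longrightarrow> semianalytic_plane {z. aff_param u w z \<in> D})"

definition semianalytic_disk :: "2 proj set \<Rightarrow> 2 proj \<Rightarrow> bool"
  where "semianalytic_disk D c \<longleftrightarrow> semianalytic D \<and>
    (\<exists>\<phi> \<psi>. homeomorphism (cball (0::complex) 1) D \<phi> \<psi> \<and> \<phi> 0 = c)"

definition real_analytic_arc :: "(real \<Rightarrow> 2 proj) \<Rightarrow> bool"
  where "real_analytic_arc g \<longleftrightarrow> arc g \<and>
    (\<forall>t0\<in>{0..1}. \<exists>u w a r. aff_frame u w \<and> r > 0 \<and>
      (\<forall>t\<in>{0..1}. \<bar>t - t0\<bar> < r \<longrightarrow>
        (\<exists>z. (\<lambda>k. a k * of_real (t - t0) ^ k) sums z \<and> g t = aff_param u w z)))"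

text \<open>
  \<open>\<delta>\<close> runs once counter-clockwise around the boundary of the disk \<open>D\<close> with centre \<open>c\<close>. The
  affine coordinate must be finite on all of \<open>D\<close>: otherwise the winding number would have the
  opposite sign.
\<close>

definition ccw_boundary_loop :: "2 proj set \<Rightarrow> 2 proj \<Rightarrow> (real \<Rightarrow> 2 proj) \<Rightarrow> bool"
  where "ccw_boundary_loop D c \<delta> \<longleftrightarrow>
    simple_path \<delta> \<and> pathfinish \<delta> = pathstart \<delta> \<and> path_image \<delta> = frontier D \<and>
    (\<exists>u w \<epsilon> z0. aff_frame u w \<and> D \<subseteq> range (aff_param u w) \<and> c = aff_param u w z0 \<and>
      path \<epsilon> \<and> (\<forall>t\<in>{0..1}. \<delta> t = aff_param u w (\<epsilon> t)) \<and> winding_number \<epsilon> z0 = 1)"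

text \<open>
  \<open>g i\<close> parametrizes the arc from \<open>\<mu>\<^sub>0\<close> to the boundary of \<open>D i\<close>, and \<open>\<delta> i\<close> the boundary of
  \<open>D i\<close>, starting at the end point of \<open>g i\<close>.
\<close>

definition loop_system ::
    "2 proj \<Rightarrow> 'i set \<Rightarrow> ('i \<Rightarrow> 2 proj) \<Rightarrow> ('i \<Rightarrow> 2 proj set) \<Rightarrow> ('i \<Rightarrow> real \<Rightarrow> 2 proj) \<Rightarrow>
      ('i \<Rightarrow> real \<Rightarrow> 2 proj) \<Rightarrow> bool"
  where "loop_system \<mu>\<^sub>0 J \<nu> D g \<delta> \<longleftrightarrow>
    disjoint_family_on D J \<and>
    (\<forall>i\<in>J. semianalytic_disk (D i) (\<nu> i) \<and>
      real_analytic_arc (g i) \<and> pathstart (g i) = \<mu>\<^sub>0 \<and> pathfinish (g i) \<in> frontier (D i) \<and>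
      path_image (g i) \<inter> D i = {pathfinish (g i)} \<and>
      ccw_boundary_loop (D i) (\<nu> i) (\<delta> i) \<and> pathstart (\<delta> i) = pathfinish (g i)) \<and>
    (\<forall>i\<in>J. \<forall>j\<in>J. i \<noteq> j \<longrightarrow>
      path_image (g i) \<inter> path_image (g j) = {\<mu>\<^sub>0} \<and> path_image (g i) \<inter> D j = {})"

definition lasso :: "(real \<Rightarrow> 2 proj) \<Rightarrow> (real \<Rightarrow> 2 proj) \<Rightarrow> real \<Rightarrow> 2 proj"
  where "lasso g \<delta> = g +++ \<delta> +++ reversepath g"


section \<open>Geometric monodromies\<close>

definition geometric_monodromy ::
    "(2 proj \<Rightarrow> 'n::finite proj set) \<Rightarrow> 'n proj set \<Rightarrow> 2 proj \<Rightarrow> 2 proj set \<Rightarrow> (real \<Rightarrow> 2 proj) \<Rightarrow>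
      ('n proj \<Rightarrow> 'n proj) \<Rightarrow> bool"
  where "geometric_monodromy P X \<mu>\<^sub>0 K \<omega> h \<longleftrightarrow>
    (\<exists>\<Theta>. continuous_on ((P \<mu>\<^sub>0 \<inter> X) \<times> {0..1}) \<Theta> \<and>
      \<Theta> ` ((P \<mu>\<^sub>0 \<inter> X) \<times> {0..1::real}) \<subseteq> part_over P X (frontier K) \<and>
      (\<forall>x \<in> P \<mu>\<^sub>0 \<inter> X. \<Theta> (x, 0) = x) \<and>
      (\<forall>t\<in>{0..1}. \<forall>x \<in> P \<mu>\<^sub>0 \<inter> X. \<Theta> (x, t) \<in> part_over P X {\<omega> t}) \<and>
      (\<forall>t\<in>{0..1}. \<exists>\<Theta>'. homeomorphism (P \<mu>\<^sub>0 \<inter> X) (part_over P X {\<omega> t}) (\<lambda>x. \<Theta> (x, t)) \<Theta>') \<and>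
      (\<forall>t\<in>{0..1}. \<forall>x \<in> pencil_axis P \<inter> X. \<Theta> (x, t) = x) \<and>
      (\<forall>x \<in> P \<mu>\<^sub>0 \<inter> X. h x = \<Theta> (x, 1)))"


section \<open>Homotopy groups and the variation operator\<close>

text \<open>Points of the cube are functions extensional on \<open>{1..q}\<close>.\<close>

definition cube :: "nat \<Rightarrow> (nat \<Rightarrow> real) topology"
  where "cube q = product_topology (\<lambda>_. top_of_set {0..1}) {1..q}"

definition rel_maps ::
    "nat \<Rightarrow> 'a::topological_space set \<Rightarrow> 'a set \<Rightarrow> 'a \<Rightarrow> ((nat \<Rightarrow> real) \<Rightarrow> 'a) set"
  where "rel_maps q A B p =
    {f. continuous_map (cube q) (top_of_set A) f \<and>
      (\<forall>x \<in> topspace (cube q). x q = 0 \<longrightarrow> f x \<in> B) \<and>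
      (\<forall>x \<in> topspace (cube q). x q = 1 \<or> (\<exists>j\<in>{1..<q}. x j \<in> {0, 1}) \<longrightarrow> f x = p)}"

definition abs_maps :: "nat \<Rightarrow> 'a::topological_space set \<Rightarrow> 'a \<Rightarrow> ((nat \<Rightarrow> real) \<Rightarrow> 'a) set"
  where "abs_maps q A p =
    {f. continuous_map (cube q) (top_of_set A) f \<and>
      (\<forall>x \<in> topspace (cube q). (\<exists>j\<in>{1..q}. x j \<in> {0, 1}) \<longrightarrow> f x = p)}"

definition rel_homotopy ::
    "nat \<Rightarrow> 'a::topological_space set \<Rightarrow> 'a set \<Rightarrow> 'a \<Rightarrow> ((nat \<Rightarrow> real) \<Rightarrow> 'a) rel"
  where "rel_homotopy q A B p =
    {(f, g). homotopic_with (\<lambda>k. k \<in> rel_maps q A B p) (cube q) (top_of_set A) f g}"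

definition abs_homotopy ::
    "nat \<Rightarrow> 'a::topological_space set \<Rightarrow> 'a \<Rightarrow> ((nat \<Rightarrow> real) \<Rightarrow> 'a) rel"
  where "abs_homotopy q A p =
    {(f, g). homotopic_with (\<lambda>k. k \<in> abs_maps q A p) (cube q) (top_of_set A) f g}"

definition rel_homotopy_set ::
    "nat \<Rightarrow> 'a::topological_space set \<Rightarrow> 'a set \<Rightarrow> 'a \<Rightarrow> ((nat \<Rightarrow> real) \<Rightarrow> 'a) set set"
  where "rel_homotopy_set q A B p = rel_maps q A B p // rel_homotopy q A B p"

definition cube_concat ::
    "((nat \<Rightarrow> real) \<Rightarrow> 'a) \<Rightarrow> ((nat \<Rightarrow> real) \<Rightarrow> 'a) \<Rightarrow> (nat \<Rightarrow> real) \<Rightarrow> 'a"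
  where "cube_concat f g x =
    (if x 1 \<le> 1/2 then f (x(1 := 2 * x 1)) else g (x(1 := 2 * x 1 - 1)))"

text \<open>
  Functions on homotopy classes are given by representatives, in the style of
  \<^theory>\<open>HOL.Equiv_Relations\<close>: the union over all representatives \<open>f\<close> of the class of the result is
  the common value of these classes.
\<close>

definition homotopy_group ::
    "nat \<Rightarrow> 'a::topological_space set \<Rightarrow> 'a \<Rightarrow> ((nat \<Rightarrow> real) \<Rightarrow> 'a) set monoid"
  where "homotopy_group q A p =
    \<lparr>carrier = abs_maps q A p // abs_homotopy q A p,
     mult = (\<lambda>c d. \<Union>f\<in>c. \<Union>g\<in>d. abs_homotopy q A p `` {cube_concat f g}),
     one = abs_homotopy q A p `` {\<lambda>_. p}\<rparr>"

text \<open>The map induced by an inclusion into \<open>A'\<close>.\<close>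

definition incl_induced ::
    "nat \<Rightarrow> 'a::topological_space set \<Rightarrow> 'a \<Rightarrow> ((nat \<Rightarrow> real) \<Rightarrow> 'a) set \<Rightarrow> ((nat \<Rightarrow> real) \<Rightarrow> 'a) set"
  where "incl_induced q A' p c = (\<Union>f\<in>c. abs_homotopy q A' p `` {f})"

definition bot_concat ::
    "nat \<Rightarrow> ((nat \<Rightarrow> real) \<Rightarrow> 'a) \<Rightarrow> ((nat \<Rightarrow> real) \<Rightarrow> 'a) \<Rightarrow> (nat \<Rightarrow> real) \<Rightarrow> 'a"
  where "bot_concat q f g x =
    (if x q \<le> 1/2 then f (x(q := 1 - 2 * x q)) else g (x(q := 2 * x q - 1)))"

text \<open>
  Here \<open>h\<close> is the geometric monodromy of \<open>A\<close>; the relative classes \<open>c\<close> are those of the pair formed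
  by \<open>A\<close> and a subspace which \<open>h\<close> fixes pointwise.
\<close>

definition VAR ::
    "nat \<Rightarrow> 'a::topological_space set \<Rightarrow> 'a \<Rightarrow> ('a \<Rightarrow> 'a) \<Rightarrow> ((nat \<Rightarrow> real) \<Rightarrow> 'a) set \<Rightarrow>
      ((nat \<Rightarrow> real) \<Rightarrow> 'a) set"
  where "VAR q A p h c = (\<Union>f\<in>c. abs_homotopy q A p `` {bot_concat q f (h \<circ> f)})"

end

theory Submission
  imports Defs
begin

text \<open>
  For a relative cube \<open>f\<close> of \<open>(\<L> \<inter> X, \<M> \<inter> X)\<close>, carrying the second half of \<open>f \<bottom> (h \<circ> f)\<close> back along
  the isotopy \<open>\<Theta>\<close> deforms it inside \<open>X\<close> into \<open>f \<bottom> f\<close>; the two halves stay glued because \<open>\<Theta>\<close> fixes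
  \<open>\<M> \<inter> X\<close>, where \<open>f\<close> takes its values on the common face. Then \<open>f \<bottom> f\<close> folds the cube along its last
  coordinate, and retracting that coordinate to \<open>1\<close> contracts it to the base point.
\<close>

section \<open>Points of the cube and changes of a single coordinate\<close>

lemma topspace_cube: "topspace (cube q) = ({1..q} \<rightarrow>\<^sub>E {0..1})"
  by (simp add: cube_def)

lemma cube_coord: "x \<in> topspace (cube q) \<Longrightarrow> j \<in> {1..q} \<Longrightarrow> x j \<in> {0..1}"
  by (auto simp: topspace_cube PiE_iff)

lemma cube_update:
  "x \<in> topspace (cube q) \<Longrightarrow> j \<in> {1..q} \<Longrightarrow> c \<in> {0..1} \<Longrightarrow> x(j := c) \<in> topspace (cube q)"
  by (auto simp: topspace_cube PiE_iff extensional_def)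

lemma continuous_map_cube_coord:
  assumes "continuous_map T (cube q) \<phi>" "j \<in> {1..q}"
  shows "continuous_map T euclideanreal (\<lambda>z. \<phi> z j)"
proof -
  have "continuous_map (cube q) (top_of_set {0..1}) (\<lambda>x. x j)"
    unfolding cube_def using assms(2) by (rule continuous_map_product_projection)
  from continuous_map_compose[OF assms(1) this] show ?thesis
    by (simp add: continuous_map_in_subtopology o_def)
qed

text \<open>Reversing, doubling or raising the last coordinate all have this shape. Continuity is
  checked componentwise; \<open>j \<in> {1..q}\<close> keeps the updated point extensional.\<close>

lemma continuous_map_cube_update:
  assumes "continuous_map T (cube q) \<phi>" "j \<in> {1..q}"
    and "continuous_map T euclideanreal c" "\<And>z. z \<in> topspace T \<Longrightarrow> c z \<in> {0..1}"
  shows "continuous_map T (cube q) (\<lambda>z. (\<phi> z)(j := c z))"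
  unfolding cube_def continuous_map_componentwise
proof (intro conjI ballI)
  show "(\<lambda>z. (\<phi> z)(j := c z)) ` topspace T \<subseteq> extensional {1..q}"
    using continuous_map_image_subset_topspace[OF assms(1)] assms(2)
    by (auto simp: topspace_cube PiE_iff extensional_def image_subset_iff)
next
  fix k assume k: "k \<in> {1..q}"
  have "\<phi> z k \<in> {0..1}" if "z \<in> topspace T" for z
    using continuous_map_image_subset_topspace[OF assms(1)] that k
    by (intro cube_coord) auto
  then show "continuous_map T (top_of_set {0..1}) (\<lambda>z. ((\<phi> z)(j := c z)) k)"
    using assms continuous_map_cube_coord[OF assms(1) k]
    by (cases "k = j") (auto simp: continuous_map_in_subtopology)
qed

section \<open>Relative cubes and their gluing along the face \<open>x q = 0\<close>\<close>

lemma rel_mapsD: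
  assumes "f \<in> rel_maps q A B p"
  shows "continuous_map (cube q) (top_of_set A) f"
    and "x \<in> topspace (cube q) \<Longrightarrow> f x \<in> A"
    and "x \<in> topspace (cube q) \<Longrightarrow> x q = 0 \<Longrightarrow> f x \<in> B"
    and "x \<in> topspace (cube q) \<Longrightarrow> x q = 1 \<Longrightarrow> f x = p"
    and "x \<in> topspace (cube q) \<Longrightarrow> j \<in> {1..<q} \<Longrightarrow> x j = 0 \<or> x j = 1 \<Longrightarrow> f x = p"
  using assms continuous_map_image_subset_topspace[of "cube q" "top_of_set A" f]
  by (auto simp: rel_maps_def)

text \<open>\<open>bot_concat\<close> reads its first half backwards, so the two halves meet on the
  face \<open>x q = 0\<close>, where \<open>FG\<close> allows pasting at every time. Every outer
  face comes from a face that \<open>F\<close> or \<open>G\<close> sends to \<open>p\<close>, so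
  each stage is an absolute cube.\<close>

lemma homotopic_bot_concat:
  fixes F G :: "real \<times> (nat \<Rightarrow> real) \<Rightarrow> 'a::topological_space"
  assumes q: "1 \<le> q"
    and F: "continuous_map (prod_topology (top_of_set {0..1}) (cube q)) (top_of_set A) F"
    and G: "continuous_map (prod_topology (top_of_set {0..1}) (cube q)) (top_of_set A) G"
    and FB: "\<And>t. t \<in> {0..1} \<Longrightarrow> (\<lambda>x. F (t, x)) \<in> rel_maps q A B p"
    and GB: "\<And>t. t \<in> {0..1} \<Longrightarrow> (\<lambda>x. G (t, x)) \<in> rel_maps q A B p"
    and FG: "\<And>t x. t \<in> {0..1} \<Longrightarrow> x \<in> topspace (cube q) \<Longrightarrow> x q = 0 \<Longrightarrow> F (t, x) = G (t, x)"
  shows "homotopic_with (\<lambda>k. k \<in> abs_maps q A p) (cube q) (top_of_set A)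
    (bot_concat q (\<lambda>x. F (0, x)) (\<lambda>x. G (0, x))) (bot_concat q (\<lambda>x. F (1, x)) (\<lambda>x. G (1, x)))"
proof -
  let ?W = "prod_topology (top_of_set {0..1::real}) (cube q)"
  let ?H = "\<lambda>z. bot_concat q (\<lambda>x. F (fst z, x)) (\<lambda>x. G (fst z, x)) (snd z)"
  have qq: "q \<in> {1..q}" using q by simp
  have coord: "continuous_map ?W euclideanreal (\<lambda>z. snd z q)"
    by (rule continuous_map_cube_coord[OF continuous_map_snd qq])
  have upd: "continuous_map ?W ?W (\<lambda>z. (fst z, (snd z)(q := c z)))"
    if "continuous_map ?W euclideanreal c" "\<And>z. c z \<in> {0..1}" for c
    using that by (intro continuous_map_pairedI continuous_map_fst
        continuous_map_cube_update[OF continuous_map_snd qq])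
  have contH: "continuous_map ?W (top_of_set A) ?H"
    unfolding bot_concat_def
  proof (rule continuous_map_cases_le[OF coord])
    show "continuous_map (subtopology ?W {z \<in> topspace ?W. snd z q \<le> 1/2}) (top_of_set A)
        (\<lambda>z. F (fst z, (snd z)(q := 1 - 2 * snd z q)))"
    proof (rule continuous_map_eq)
      \<comment> \<open>Clamping to the unit interval gives a map on all of \<open>?W\<close>, to
        which \<open>upd\<close> applies; on the half \<open>snd z q \<le> 1/2\<close> it agrees
        with the unclamped one. The other half is treated alike.\<close>
      have "continuous_map ?W ?W (\<lambda>z. (fst z, (snd z)(q := max 0 (min 1 (1 - 2 * snd z q)))))"
        by (rule upd) (auto intro!: continuous_intros coord)
      then show "continuous_map (subtopology ?W {z \<in> topspace ?W. snd z q \<le> 1/2}) (top_of_set A)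
          (F \<circ> (\<lambda>z. (fst z, (snd z)(q := max 0 (min 1 (1 - 2 * snd z q))))))"
        by (intro continuous_map_from_subtopology continuous_map_compose[OF _ F])
    qed (use cube_coord[OF _ qq] in \<open>force simp: min_def max_def\<close>)
    show "continuous_map (subtopology ?W {z \<in> topspace ?W. 1/2 \<le> snd z q}) (top_of_set A)
        (\<lambda>z. G (fst z, (snd z)(q := 2 * snd z q - 1)))"
    proof (rule continuous_map_eq)
      have "continuous_map ?W ?W (\<lambda>z. (fst z, (snd z)(q := max 0 (min 1 (2 * snd z q - 1)))))"
        by (rule upd) (auto intro!: continuous_intros coord)
      then show "continuous_map (subtopology ?W {z \<in> topspace ?W. 1/2 \<le> snd z q}) (top_of_set A)
          (G \<circ> (\<lambda>z. (fst z, (snd z)(q := max 0 (min 1 (2 * snd z q - 1))))))"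
        by (intro continuous_map_from_subtopology continuous_map_compose[OF _ G])
    qed (use cube_coord[OF _ qq] in \<open>force simp: min_def max_def\<close>)
    show "F (fst z, (snd z)(q := 1 - 2 * snd z q)) = G (fst z, (snd z)(q := 2 * snd z q - 1))"
      if "z \<in> topspace ?W" "snd z q = 1/2" for z
    proof -
      have "1 - 2 * snd z q = 0" "2 * snd z q - 1 = 0" using that(2) by simp_all
      then show ?thesis using that(1) by (auto intro!: FG cube_update[OF _ qq])
    qed
  qed auto
  show ?thesis
    unfolding homotopic_with_def
  proof (intro exI[of _ ?H] conjI allI ballI contH)
    fix t :: real assume t: "t \<in> {0..1}"
    show "(\<lambda>x. ?H (t, x)) \<in> abs_maps q A p"
      unfolding abs_maps_def mem_Collect_eq
    proof (intro conjI ballI impI)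
      show "continuous_map (cube q) (top_of_set A) (\<lambda>x. ?H (t, x))"
        using continuous_map_o_Pair[OF contH, of t] t by (simp add: o_def)
    next
      fix x assume x: "x \<in> topspace (cube q)" and "\<exists>j\<in>{1..q}. x j \<in> {0, 1}"
      then obtain j where j: "j \<in> {1..q}" "x j = 0 \<or> x j = 1" by auto
      note xq = cube_coord[OF x qq]
      have c: "x q \<le> 1/2 \<Longrightarrow> x(q := 1 - 2 * x q) \<in> topspace (cube q)"
        "\<not> x q \<le> 1/2 \<Longrightarrow> x(q := 2 * x q - 1) \<in> topspace (cube q)"
        using xq by (auto intro!: cube_update[OF x qq])
      show "?H (t, x) = p"
      \<comment> \<open>The faces \<open>x q = 0\<close> and \<open>x q = 1\<close> of the
        concatenation are the faces with last coordinate 1 of \<open>F\<close> and of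
        \<open>G\<close>. For \<open>j \<noteq> q\<close> the update leaves \<open>x j\<close> at 0
        or 1.\<close>
      proof (cases "j = q")
        case True
        then show ?thesis using j c rel_mapsD(4)[OF FB[OF t]] rel_mapsD(4)[OF GB[OF t]]
          by (auto simp: bot_concat_def)
      next
        case False
        then have "j \<in> {1..<q}" using j by auto
        with False show ?thesis
          using j c rel_mapsD(5)[OF FB[OF t], of _ j] rel_mapsD(5)[OF GB[OF t], of _ j]
          by (auto simp: bot_concat_def)
      qed
    qed
  qed auto
qed

section \<open>Change of spaces and of representatives\<close>

text \<open>Fixing \<open>B\<close> pointwise keeps the face \<open>x q = 0\<close> in
  \<open>B\<close>, and \<open>p \<in> B\<close> keeps the other faces at \<open>p\<close>. Applied
  with \<open>k\<close> the monodromy and with \<open>k\<close> a stage of the isotopy, which moves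
  \<open>A\<close> inside a larger space.\<close>

lemma rel_maps_compose:
  assumes f: "f \<in> rel_maps q A B p" and k: "continuous_on A k" "k ` A \<subseteq> A'"
    and fix_B: "\<And>x. x \<in> B \<Longrightarrow> k x = x" and p: "p \<in> B"
  shows "k \<circ> f \<in> rel_maps q A' B p"
proof -
  have "continuous_map (top_of_set A) (top_of_set A') k"
    using k by (auto simp: continuous_map_in_subtopology)
  from continuous_map_compose[OF rel_mapsD(1)[OF f] this]
  show ?thesis
    unfolding rel_maps_def mem_Collect_eq
    using f fix_B p by (auto simp: rel_maps_def)
qed

lemma rel_maps_mono: "A \<subseteq> A' \<Longrightarrow> rel_maps q A B p \<subseteq> rel_maps q A' B p"
  by (auto simp: rel_maps_def continuous_map_in_subtopology)

lemma abs_maps_mono: "A \<subseteq> A' \<Longrightarrow> abs_maps q A p \<subseteq> abs_maps q A' p"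
  by (auto simp: abs_maps_def continuous_map_in_subtopology)

lemma abs_homotopy_mono:
  fixes A :: "'a::topological_space set"
  assumes "A \<subseteq> A'" "(f, g) \<in> abs_homotopy q A p"
  shows "(f, g) \<in> abs_homotopy q A' p"
proof -
  \<comment> \<open>The space enters \<open>homotopic_with\<close> twice: first the property of the
    stages is weakened from \<open>A\<close> to \<open>A'\<close>, then the target is
    enlarged.\<close>
  have "homotopic_with (\<lambda>k. k \<in> abs_maps q A' p) (cube q) (top_of_set A) f g"
    using assms(2) abs_maps_mono[OF assms(1), of q p] unfolding abs_homotopy_def
    by (force elim!: homotopic_with_mono)
  moreover have "continuous_map T (top_of_set A') k" if "continuous_map T (top_of_set A) k" for k and T :: "(real \<times> (nat \<Rightarrow> real)) topology"
    using that assms(1) by (auto simp: continuous_map_in_subtopology)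
  ultimately show ?thesis
    unfolding abs_homotopy_def homotopic_with_def by blast
qed

lemma abs_homotopy_sym: "(f, g) \<in> abs_homotopy q A p \<Longrightarrow> (g, f) \<in> abs_homotopy q A p"
  by (simp add: abs_homotopy_def homotopic_with_symD)

lemma abs_homotopy_trans:
  "(f, g) \<in> abs_homotopy q A p \<Longrightarrow> (g, k) \<in> abs_homotopy q A p \<Longrightarrow> (f, k) \<in> abs_homotopy q A p"
  unfolding abs_homotopy_def using homotopic_with_trans by auto

lemma abs_homotopy_class_eq:
  "(f, g) \<in> abs_homotopy q A p \<Longrightarrow> abs_homotopy q A p `` {f} = abs_homotopy q A p `` {g}"
  by (auto intro: abs_homotopy_trans abs_homotopy_sym)

text \<open>Cubes are total functions with arbitrary values off \<open>topspace (cube q)\<close>, so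
  a stage of a homotopy often equals the intended map on the cube only.\<close>

lemma abs_homotopy_if_eq_on_cube:
  assumes "f \<in> abs_maps q A p" "\<And>x. x \<in> topspace (cube q) \<Longrightarrow> f x = g x"
  shows "(f, g) \<in> abs_homotopy q A p"
proof -
  have "g \<in> abs_maps q A p"
    using assms continuous_map_eq[of "cube q" "top_of_set A" f g] by (auto simp: abs_maps_def)
  then show ?thesis
    using assms by (auto simp: abs_homotopy_def abs_maps_def intro!: homotopic_with_equal)
qed

section \<open>Variation and inclusion on homotopy classes\<close>

text \<open>This makes the variation well defined. A homotopy \<open>F\<close> from \<open>f\<close>
  to \<open>f'\<close> and the homotopy \<open>h \<circ> F\<close> agree on the face
  \<open>x q = 0\<close>, because \<open>F\<close> takes values in \<open>B\<close> there and
  \<open>h\<close> fixes \<open>B\<close>; hence they glue.\<close>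

lemma bot_concat_rel_homotopy:
  assumes q: "1 \<le> q" and h: "continuous_on A h" "h ` A \<subseteq> A" "\<And>x. x \<in> B \<Longrightarrow> h x = x"
    and p: "p \<in> B" and ff: "(f, f') \<in> rel_homotopy q A B p"
  shows "(bot_concat q f (h \<circ> f), bot_concat q f' (h \<circ> f')) \<in> abs_homotopy q A p"
proof -
  obtain F where F: "continuous_map (prod_topology (top_of_set {0..1::real}) (cube q)) (top_of_set A) F"
    and ends: "\<And>x. F (0, x) = f x" "\<And>x. F (1, x) = f' x"
    and FB: "\<And>t. t \<in> {0..1} \<Longrightarrow> (\<lambda>x. F (t, x)) \<in> rel_maps q A B p"
    using ff unfolding rel_homotopy_def homotopic_with_def by auto
  have "continuous_map (top_of_set A) (top_of_set A) h"
    using h by (auto simp: continuous_map_in_subtopology)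
  then have G: "continuous_map (prod_topology (top_of_set {0..1}) (cube q)) (top_of_set A) (h \<circ> F)"
    using F by (rule continuous_map_compose[rotated])
  have GB: "(\<lambda>x. (h \<circ> F) (t, x)) \<in> rel_maps q A B p" if "t \<in> {0..1}" for t
    using rel_maps_compose[OF FB[OF that] h p] by (simp add: o_def)
  have "(h \<circ> F) (t, x) = F (t, x)" if "t \<in> {0..1}" "x \<in> topspace (cube q)" "x q = 0" for t x
    using h(3) rel_mapsD(3)[OF FB] that by simp
  then have "homotopic_with (\<lambda>k. k \<in> abs_maps q A p) (cube q) (top_of_set A)
      (bot_concat q (\<lambda>x. F (0, x)) (\<lambda>x. (h \<circ> F) (0, x)))
      (bot_concat q (\<lambda>x. F (1, x)) (\<lambda>x. (h \<circ> F) (1, x)))"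
    using FB GB by (intro homotopic_bot_concat[where B = B] q F G) auto
  then show ?thesis
    by (simp add: abs_homotopy_def ends o_def)
qed

text \<open>The union in \<open>VAR\<close> collapses: it is indexed by a set containing
  \<open>f\<close>, and all its members coincide by \<open>bot_concat_rel_homotopy\<close>.\<close>

lemma VAR_class:
  assumes "1 \<le> q" "continuous_on A h" "h ` A \<subseteq> A" "\<And>x. x \<in> B \<Longrightarrow> h x = x" "p \<in> B"
    and f: "f \<in> rel_maps q A B p"
  shows "VAR q A p h (rel_homotopy q A B p `` {f}) = abs_homotopy q A p `` {bot_concat q f (h \<circ> f)}"
proof -
  have "f \<in> rel_homotopy q A B p `` {f}"
    using f by (auto simp: rel_homotopy_def rel_mapsD(1))
  moreover have "abs_homotopy q A p `` {bot_concat q f' (h \<circ> f')} =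
      abs_homotopy q A p `` {bot_concat q f (h \<circ> f)}" if "f' \<in> rel_homotopy q A B p `` {f}" for f'
    using that by (intro abs_homotopy_class_eq[symmetric] bot_concat_rel_homotopy[OF assms(1-5)]) auto
  ultimately show ?thesis
    unfolding VAR_def by blast
qed

text \<open>The same collapse of a union, now because a homotopy inside \<open>A\<close> is also one
  inside \<open>A'\<close>.\<close>

lemma incl_induced_class:
  assumes "A \<subseteq> A'" "f \<in> abs_maps q A p"
  shows "incl_induced q A' p (abs_homotopy q A p `` {f}) = abs_homotopy q A' p `` {f}"
proof -
  have "f \<in> abs_homotopy q A p `` {f}"
    using assms(2) by (auto simp: abs_homotopy_def abs_maps_def)
  moreover have "abs_homotopy q A' p `` {f'} = abs_homotopy q A' p `` {f}"
    if "f' \<in> abs_homotopy q A p `` {f}" for f'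
    using that by (intro abs_homotopy_class_eq[symmetric] abs_homotopy_mono[OF assms(1)]) auto
  ultimately show ?thesis
    unfolding incl_induced_def by blast
qed

section \<open>Null-homotopies\<close>

lemma bot_concat_self_null_homotopic:
  assumes q: "1 \<le> q" and f: "f \<in> rel_maps q A B p"
  shows "(bot_concat q f f, \<lambda>_. p) \<in> abs_homotopy q A p"
proof -
  let ?W = "prod_topology (top_of_set {0..1::real}) (cube q)"
  \<comment> \<open>The last coordinate is pushed up to at least \<open>t\<close>: \<open>F\<close>
    starts at \<open>f\<close> and ends with \<open>f\<close> read on the face
    \<open>x q = 1\<close>, which is sent to \<open>p\<close>.\<close>
  define F where "F = (\<lambda>(t, x). f (x(q := max (x q) t)))"
  have qq: "q \<in> {1..q}" using q by simp
  have upd: "x(q := max (x q) t) \<in> topspace (cube q)"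
    if "x \<in> topspace (cube q)" "t \<in> {0..1}" for x t
    using that cube_coord[OF that(1) qq] by (intro cube_update[OF _ qq]) auto
  have "continuous_map ?W euclideanreal fst"
    using continuous_map_fst[of "top_of_set {0..1::real}" "cube q"]
    by (simp add: continuous_map_in_subtopology)
  then have "continuous_map ?W euclideanreal (\<lambda>z. max (snd z q) (fst z))"
    by (intro continuous_map_real_max continuous_map_cube_coord[OF continuous_map_snd qq])
  then have "continuous_map ?W (cube q) (\<lambda>z. (snd z)(q := max (snd z q) (fst z)))"
    by (rule continuous_map_cube_update[OF continuous_map_snd qq])
      (use cube_coord[OF _ qq] in \<open>force simp: max_def\<close>)
  from continuous_map_compose[OF this rel_mapsD(1)[OF f]]
  have F: "continuous_map ?W (top_of_set A) F"
    by (simp add: F_def o_def case_prod_unfold)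
  \<comment> \<open>At time \<open>t\<close> the face \<open>x q = 0\<close> carries the values of
    \<open>f\<close> at height \<open>t\<close>, which may leave \<open>B\<close>; so the pair is
    relaxed to \<open>(A, A)\<close>. Gluing still works because both halves are the same
    \<open>F\<close>.\<close>
  have FA: "(\<lambda>x. F (t, x)) \<in> rel_maps q A A p" if t: "t \<in> {0..1}" for t
    unfolding rel_maps_def mem_Collect_eq
  proof (intro conjI ballI impI)
    show "continuous_map (cube q) (top_of_set A) (\<lambda>x. F (t, x))"
      using continuous_map_o_Pair[OF F, of t] t by (simp add: o_def)
  next
    fix x assume x: "x \<in> topspace (cube q)"
    show "F (t, x) \<in> A"
      using rel_mapsD(2)[OF f upd[OF x t]] by (simp add: F_def)
    assume "x q = 1 \<or> (\<exists>j\<in>{1..<q}. x j \<in> {0, 1})"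
    then show "F (t, x) = p"
      using rel_mapsD(4,5)[OF f upd[OF x t]] t by (fastforce simp: F_def max_def)
  qed
  let ?b = "\<lambda>t. bot_concat q (\<lambda>x. F (t, x)) (\<lambda>x. F (t, x))"
  have "(?b 0, ?b 1) \<in> abs_homotopy q A p"
    unfolding abs_homotopy_def mem_Collect_eq case_prod_conv
    by (rule homotopic_bot_concat[where B = A and F = F and G = F]) (use q F FA in auto)
  moreover from this have b: "?b 0 \<in> abs_maps q A p" "?b 1 \<in> abs_maps q A p"
    unfolding abs_homotopy_def by (auto dest: homotopic_with_imp_property)
  have "?b 0 x = bot_concat q f f x" "?b 1 x = p" if x: "x \<in> topspace (cube q)" for x
  proof -
    note xq = cube_coord[OF x qq]
    show "?b 0 x = bot_concat q f f x"
      using xq by (auto simp: bot_concat_def F_def)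
    have "f (x(q := 1)) = p"
      using rel_mapsD(4)[OF f cube_update[OF x qq, of 1]] by simp
    then show "?b 1 x = p"
      using xq by (auto simp: bot_concat_def F_def max_def)
  qed
  then have "(?b 0, bot_concat q f f) \<in> abs_homotopy q A p" "(?b 1, \<lambda>_. p) \<in> abs_homotopy q A p"
    using b by (intro abs_homotopy_if_eq_on_cube; simp)+
  ultimately show ?thesis
    by (meson abs_homotopy_trans abs_homotopy_sym)
qed

text \<open>The stages of \<open>\<Theta>\<close> may leave \<open>A\<close>, so the null-homotopy
  lives in \<open>X\<close>. With the first half constant, the second runs from
  \<open>h \<circ> f\<close> back to \<open>f\<close>, and the result is a folded cube.\<close>

lemma bot_concat_isotopy_null_homotopic:
  assumes q: "1 \<le> q" and f: "f \<in> rel_maps q A B p" and p: "p \<in> B" and "A \<subseteq> X"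
    and \<Theta>: "continuous_on (A \<times> {0..1::real}) \<Theta>" "\<Theta> ` (A \<times> {0..1}) \<subseteq> X"
    and start: "\<And>x. x \<in> A \<Longrightarrow> \<Theta> (x, 0) = x"
    and fix_B: "\<And>x t. x \<in> B \<Longrightarrow> t \<in> {0..1} \<Longrightarrow> \<Theta> (x, t) = x"
    and h: "\<And>x. x \<in> A \<Longrightarrow> h x = \<Theta> (x, 1)"
  shows "(bot_concat q f (h \<circ> f), \<lambda>_. p) \<in> abs_homotopy q X p"
proof -
  let ?W = "prod_topology (top_of_set {0..1::real}) (cube q)"
  have qq: "q \<in> {1..q}" using q by simp
  define F where "F = (\<lambda>z::real \<times> (nat \<Rightarrow> real). f (snd z))"
  \<comment> \<open>Isotopy time is reversed: \<open>G\<close> is \<open>h \<circ> f\<close> at time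
    0 and \<open>f\<close> at time 1.\<close>
  define G where "G = (\<lambda>z. \<Theta> (f (snd z), 1 - fst z))"
  have fX: "f \<in> rel_maps q X B p"
    using f rel_maps_mono[OF \<open>A \<subseteq> X\<close>] by blast
  have fsnd: "continuous_map ?W (top_of_set A) (\<lambda>z. f (snd z))"
    using continuous_map_compose[OF continuous_map_snd rel_mapsD(1)[OF f]] by (simp add: o_def)
  then have F: "continuous_map ?W (top_of_set X) F"
    using \<open>A \<subseteq> X\<close> by (auto simp: F_def continuous_map_in_subtopology)
  have "continuous_map ?W euclideanreal fst"
    using continuous_map_fst[of "top_of_set {0..1::real}" "cube q"]
    by (simp add: continuous_map_in_subtopology)
  then have "continuous_map ?W (top_of_set {0..1}) (\<lambda>z. 1 - fst z)"
    by (auto simp: continuous_map_in_subtopology intro!: continuous_intros)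
  \<comment> \<open>The subspace topology on \<open>A \<times> {0..1}\<close> is rewritten as a
    product topology, so that the pair is continuous once its components are.\<close>
  with fsnd have "continuous_map ?W (top_of_set (A \<times> {0..1})) (\<lambda>z. (f (snd z), 1 - fst z))"
    unfolding subtopology_Times[of euclidean euclidean, unfolded prod_topology_euclidean] by (rule continuous_map_pairedI)
  moreover have "continuous_map (top_of_set (A \<times> {0..1})) (top_of_set X) \<Theta>"
    using \<Theta> by (auto simp: continuous_map_in_subtopology)
  ultimately have G: "continuous_map ?W (top_of_set X) G"
    unfolding G_def by (rule continuous_map_compose[unfolded o_def])
  have GB: "(\<lambda>x. G (t, x)) \<in> rel_maps q X B p" if t: "t \<in> {0..1}" for t
  proof -
    have "continuous_on A (\<lambda>x. \<Theta> (x, 1 - t))"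
      using t by (intro continuous_on_compose2[OF \<Theta>(1)] continuous_intros) auto
    moreover have "(\<lambda>x. \<Theta> (x, 1 - t)) ` A \<subseteq> X" using \<Theta>(2) t by auto
    ultimately have "(\<lambda>x. \<Theta> (x, 1 - t)) \<circ> f \<in> rel_maps q X B p"
      using rel_maps_compose[OF f _ _ _ p] fix_B t by simp
    then show ?thesis by (simp add: G_def o_def)
  qed
  have glue: "F (t, x) = G (t, x)" if "t \<in> {0..1}" "x \<in> topspace (cube q)" "x q = 0" for t x
    using that fix_B[OF rel_mapsD(3)[OF f]] by (simp add: F_def G_def)
  let ?b = "\<lambda>t. bot_concat q (\<lambda>x. F (t, x)) (\<lambda>x. G (t, x))"
  have "(?b 0, ?b 1) \<in> abs_homotopy q X p"
    unfolding abs_homotopy_def mem_Collect_eq case_prod_conv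
    by (rule homotopic_bot_concat[where B = B and F = F and G = G])
      (use q F G GB glue fX in \<open>auto simp: F_def\<close>)
  moreover from this have b: "?b 0 \<in> abs_maps q X p" "?b 1 \<in> abs_maps q X p"
    unfolding abs_homotopy_def by (auto dest: homotopic_with_imp_property)
  have "?b 0 x = bot_concat q f (h \<circ> f) x" "?b 1 x = bot_concat q f f x"
    if x: "x \<in> topspace (cube q)" for x
  proof -
    \<comment> \<open>\<open>h\<close> and the start of \<open>\<Theta>\<close> are described on
      \<open>A\<close> only, so in the second half the argument of \<open>f\<close> must be known to
      lie in the cube.\<close>
    have "x(q := 2 * x q - 1) \<in> topspace (cube q)" if "\<not> x q \<le> 1/2"
      using cube_coord[OF x qq] that by (intro cube_update[OF x qq]) auto
    from rel_mapsD(2)[OF f this]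
    show "?b 0 x = bot_concat q f (h \<circ> f) x" "?b 1 x = bot_concat q f f x"
      by (auto simp: bot_concat_def F_def G_def h start)
  qed
  then have "(?b 0, bot_concat q f (h \<circ> f)) \<in> abs_homotopy q X p"
    "(?b 1, bot_concat q f f) \<in> abs_homotopy q X p"
    using b by (intro abs_homotopy_if_eq_on_cube; simp)+
  moreover have "(bot_concat q f f, \<lambda>_. p) \<in> abs_homotopy q X p"
    using q fX by (rule bot_concat_self_null_homotopic)
  ultimately show ?thesis
    by (meson abs_homotopy_trans abs_homotopy_sym)
qed

section \<open>From the isotopy above the loop to the kernel of the inclusion\<close>

theorem lemma4p8:
  fixes n q :: nat
    and X Y Z :: "'m::finite proj set"
    and \<S> :: "'m proj set set"
    and P :: "2 proj \<Rightarrow> 'm proj set"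
    and \<L> \<M> :: "'m proj set"
    and \<mu>\<^sub>0 :: "2 proj"
    and J :: "'i set"
    and \<nu> :: "'i \<Rightarrow> 2 proj"
    and D :: "'i \<Rightarrow> 2 proj set"
    and g \<delta> :: "'i \<Rightarrow> real \<Rightarrow> 2 proj"
    and p :: "'m proj"
    and i :: 'i
    and h :: "'m proj \<Rightarrow> 'm proj"
  assumes "n \<ge> 2" and "CARD('m) = n + 1"
    and "closed_algebraic Y" and "Y \<noteq> {}"
    and "closed_algebraic Z" and "Z \<subset> Y"
    and "X = Y - Z"
    and "whitney_stratification Y \<S>" and "\<exists>\<T>\<subseteq>\<S>. Z = \<Union>\<T>"
    and "is_pencil P" and "\<L> = P \<mu>\<^sub>0" and "\<M> = pencil_axis P"
    and "transverse_to_strata \<L> \<S>" and "transverse_to_strata \<M> \<S>"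
    and "finite J" and "\<And>j. j \<in> J \<Longrightarrow> \<nu> j \<noteq> \<mu>\<^sub>0"
    and "\<And>\<mu>. \<mu> \<notin> \<nu> ` J \<Longrightarrow> transverse_to_strata (P \<mu>) \<S>"
    and "loop_system \<mu>\<^sub>0 J \<nu> D g \<delta>"
    and "\<M> \<inter> X \<noteq> {}" and "p \<in> \<M> \<inter> X"
    and "i \<in> J" and "q \<ge> 1"
    and "geometric_monodromy P X \<mu>\<^sub>0 (path_image (g i) \<union> D i) (lasso (g i) (\<delta> i)) h"
  shows "VAR q (\<L> \<inter> X) p h ` rel_homotopy_set q (\<L> \<inter> X) (\<M> \<inter> X) p
           \<subseteq> kernel (homotopy_group q (\<L> \<inter> X) p) (homotopy_group q X p) (incl_induced q X p)"
proof -
  let ?A = "\<L> \<inter> X" and ?B = "\<M> \<inter> X"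
  let ?K = "path_image (g i) \<union> D i" and ?\<omega> = "lasso (g i) (\<delta> i)"
  have mono: "geometric_monodromy P X \<mu>\<^sub>0 ?K ?\<omega> h" by fact
  then obtain \<Theta> where \<Theta>: "continuous_on (?A \<times> {0..1::real}) \<Theta>"
      "\<Theta> ` (?A \<times> {0..1}) \<subseteq> part_over P X (frontier ?K)"
    and start: "\<And>x. x \<in> ?A \<Longrightarrow> \<Theta> (x, 0) = x"
    and fibre: "\<And>x t. x \<in> ?A \<Longrightarrow> t \<in> {0..1} \<Longrightarrow> \<Theta> (x, t) \<in> part_over P X {?\<omega> t}"
    and fix_M: "\<And>x t. x \<in> ?B \<Longrightarrow> t \<in> {0..1} \<Longrightarrow> \<Theta> (x, t) = x"
    and h: "\<And>x. x \<in> ?A \<Longrightarrow> h x = \<Theta> (x, 1)"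
    unfolding geometric_monodromy_def \<open>\<L> = P \<mu>\<^sub>0\<close>[symmetric] \<open>\<M> = pencil_axis P\<close>[symmetric]
    by (elim exE conjE) (rule that; (assumption | (erule (1) bspec) | (drule (1) bspec, erule (1) bspec)))
  have "part_over P X (frontier ?K) \<subseteq> X" by (auto simp: part_over_def)
  with \<Theta>(2) have \<Theta>X: "\<Theta> ` (?A \<times> {0..1}) \<subseteq> X" by blast
  have "?B \<subseteq> ?A"
    unfolding \<open>\<L> = P \<mu>\<^sub>0\<close> \<open>\<M> = pencil_axis P\<close> pencil_axis_def by blast
  have "pathstart (g i) = \<mu>\<^sub>0"
    using \<open>loop_system \<mu>\<^sub>0 J \<nu> D g \<delta>\<close> \<open>i \<in> J\<close> by (simp add: loop_system_def)
  \<comment> \<open>The loop closes up: it ends with \<open>g i\<close> reversed. Hence the last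
    stage of \<open>\<Theta>\<close> lands in the fibre over \<open>\<mu>\<^sub>0\<close>, and
    \<open>h\<close> maps \<open>\<L> \<inter> X\<close> into itself.\<close>
  then have "pathfinish ?\<omega> = \<mu>\<^sub>0" by (simp add: lasso_def)
  then have "h ` ?A \<subseteq> ?A"
    using fibre[of _ 1] h by (auto simp: part_over_def pathfinish_def \<open>\<L> = P \<mu>\<^sub>0\<close>)
  have "continuous_on ?A (\<lambda>x. \<Theta> (x, 1))"
    by (intro continuous_on_compose2[OF \<Theta>(1)] continuous_intros) auto
  then have "continuous_on ?A h"
    by (rule continuous_on_eq) (simp add: h)
  have fix_h: "h x = x" if "x \<in> ?B" for x
    using that \<open>?B \<subseteq> ?A\<close> h[of x] fix_M[of x 1] by auto
  show ?thesis
  proof (rule image_subsetI)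
    fix c assume "c \<in> rel_homotopy_set q ?A ?B p"
    then obtain f where f: "f \<in> rel_maps q ?A ?B p" and c: "c = rel_homotopy q ?A ?B p `` {f}"
      unfolding rel_homotopy_set_def by (rule quotientE)
    let ?b = "bot_concat q f (h \<circ> f)"
    have VAR_c: "VAR q ?A p h c = abs_homotopy q ?A p `` {?b}"
      unfolding c using f
      by (intro VAR_class \<open>q \<ge> 1\<close> \<open>continuous_on ?A h\<close> \<open>h ` ?A \<subseteq> ?A\<close> fix_h \<open>p \<in> ?B\<close>)
    \<comment> \<open>That \<open>?b\<close> is an absolute cube follows from the invariance lemma
      applied to the constant homotopy: the ends of a homotopy satisfy the property of its
      stages.\<close>
    have "(f, f) \<in> rel_homotopy q ?A ?B p"
      using f by (simp add: rel_homotopy_def rel_mapsD(1))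
    then have "(?b, ?b) \<in> abs_homotopy q ?A p"
      by (intro bot_concat_rel_homotopy[where B = ?B] \<open>q \<ge> 1\<close> \<open>continuous_on ?A h\<close>
          \<open>h ` ?A \<subseteq> ?A\<close> fix_h \<open>p \<in> ?B\<close>)
    then have b: "?b \<in> abs_maps q ?A p"
      by (auto simp: abs_homotopy_def dest: homotopic_with_imp_property)
    have "(?b, \<lambda>_. p) \<in> abs_homotopy q X p"
      using bot_concat_isotopy_null_homotopic[OF \<open>q \<ge> 1\<close> f \<open>p \<in> ?B\<close> _ \<Theta>(1) \<Theta>X start fix_M h]
      by simp
    then have "incl_induced q X p (VAR q ?A p h c) = \<one>\<^bsub>homotopy_group q X p\<^esub>"
      using incl_induced_class[OF _ b, of X]
      by (simp add: VAR_c homotopy_group_def abs_homotopy_class_eq)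
    \<comment> \<open>\<open>kernel\<close> collects only elements of the carrier, so membership of
      the variation in the group of \<open>\<L> \<inter> X\<close> is shown separately.\<close>
    moreover have "VAR q ?A p h c \<in> carrier (homotopy_group q ?A p)"
      using b by (simp add: VAR_c homotopy_group_def quotientI)
    ultimately show "VAR q ?A p h c \<in>
        kernel (homotopy_group q ?A p) (homotopy_group q X p) (incl_induced q X p)"
      by (simp add: kernel_def)
  qed
qed

end
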